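(* Let $|A|<1$. Then $$\mathcal{K}^{lc,\Lambda_A}=\mathcal{K}^{2,\Lambda_A}=\bar{\mathcal{U}}_A.$$
   Context: $\mathbb{R}^2\simeq\mathbb{C}$ with $\mathbf{i}=(0,1)$ the imaginary unit; products of elements of $\mathbb{R}^2$ are complex products. $\mathcal{K}=\{z=(\theta,\mathbf{u},\mathbf{m})\in[-1,1]\times\mathbb{R}^2\times\mathbb{R}^2:|\theta|=1,\ \mathbf{m}=\theta\mathbf{u}\}$. Wave cone: $\Lambda_A=\varLambda_0\cup\varLambda_1\subset\mathbb{R}^5$, $\varLambda_0=\{\bar z:\bar\theta=0,\ \bar{\mathbf{u}}=-A\bar{\mathbf{m}}\}$, $\varLambda_1=\{\bar z:\bar\theta\neq0,\ \bar{\mathbf{u}}=\bar\omega(A\bar{\mathbf{m}}+\bar\theta\mathbf{i})\text{ for some }\bar\omega\text{ with }|2\bar\omega+1|=1\}$. For a set $K$ and a cone $\Lambda$ in $\mathbb{R}^N$: $K^{1,\Lambda}=\{\tfrac{1+s}{2}z_1+\tfrac{1-s}{2}z_2:s\in[-1,1],\ z_1,z_2\in K,\ z_1-z_2\in\Lambda\}$, $K^{n,\Lambda}=(K^{n-1,\Lambda})^{1,\Lambda}$ for $n\ge2$, and the $\Lambda$-lamination hull is $K^{lc,\Lambda}=\bigcup_{n\ge1}K^{n,\Lambda}$. $\bar{\mathcal{U}}_A$ is the closure of the open set $\mathcal{U}_A$ of $z\in[-1,1]\times\mathbb{R}^2\times\mathbb{R}^2$ with $|2(1-\theta A)(\mathbf{m}-\theta\mathbf{u})+(1-\theta^2)(A\mathbf{u}+\mathbf{i})|<(1-\theta^2)|A\mathbf{u}+\mathbf{i}|$.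 *)

theory Defs
  imports "HOL-Analysis.Analysis"
begin

text \<open>
  The plane is identified with the complex numbers, so a state
  \<open>z = (\<theta>, u, m)\<close> in five-dimensional Euclidean space has type \<open>real \<times> complex \<times> complex\<close>.
\<close>

type_synonym state = "real \<times> complex \<times> complex"

definition constraint_set :: "state set" where
  "constraint_set = {(\<theta>, u, m). \<theta> \<in> {-1..1} \<and> \<bar>\<theta>\<bar> = 1 \<and> m = of_real \<theta> * u}"

definition wave_cone0 :: "real \<Rightarrow> state set" where
  "wave_cone0 A = {(\<theta>, u, m). \<theta> = 0 \<and> u = - (of_real A * m)}"

definition wave_cone1 :: "real \<Rightarrow> state set" where
  "wave_cone1 A = {(\<theta>, u, m). \<theta> \<noteq> 0 \<and>
     (\<exists>\<omega>::complex. cmod (2 * \<omega> + 1) = 1 \<and> u = \<omega> * (of_real A * m + of_real \<theta> * \<i>))}"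

definition wave_cone :: "real \<Rightarrow> state set" where
  "wave_cone A = wave_cone0 A \<union> wave_cone1 A"

definition laminate_step :: "'a::real_vector set \<Rightarrow> 'a set \<Rightarrow> 'a set" where
  "laminate_step \<Lambda> K =
     {((1 + s) / 2) *\<^sub>R z1 + ((1 - s) / 2) *\<^sub>R z2 | s z1 z2.
        s \<in> {-1..1} \<and> z1 \<in> K \<and> z2 \<in> K \<and> z1 - z2 \<in> \<Lambda>}"

text \<open>
  \<open>laminates \<Lambda> K n\<close> is the set of laminates of order \<open>n \<ge> 1\<close>; the value \<open>K\<close> at
  \<open>n = 0\<close> only starts the recursion and is left out of the hull below.
\<close>

primrec laminates :: "'a::real_vector set \<Rightarrow> 'a set \<Rightarrow> nat \<Rightarrow> 'a set" where
  "laminates \<Lambda> K 0 = K"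
| "laminates \<Lambda> K (Suc n) = laminate_step \<Lambda> (laminates \<Lambda> K n)"

definition lamination_hull :: "'a::real_vector set \<Rightarrow> 'a set \<Rightarrow> 'a set" where
  "lamination_hull \<Lambda> K = (\<Union>n\<in>{1..}. laminates \<Lambda> K n)"

definition U_set :: "real \<Rightarrow> state set" where
  "U_set A = {(\<theta>, u, m). \<theta> \<in> {-1..1} \<and>
     cmod (2 * (1 - of_real \<theta> * of_real A) * (m - of_real \<theta> * u)
           + (1 - (of_real \<theta>)\<^sup>2) * (of_real A * u + \<i>))
       < (1 - \<theta>\<^sup>2) * cmod (of_real A * u + \<i>)}"

end

theory Submission
  imports Defs
begin

text \<open>
  Put \<open>w = m - \<theta>u\<close> and \<open>E = Au + \<i>\<close>. Squaring the inequality that defines \<open>U_set A\<close> turns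
  it into \<open>G < 0\<close> for the polynomial \<open>G = (1 - \<theta>A)|w|\<^sup>2 + (1 - \<theta>\<^sup>2)\<langle>w, E\<rangle>\<close>, and the closure is
  \<open>G \<le> 0\<close>. States with \<open>G = 0\<close> are first order laminates, and along a direction of \<open>wave_cone0\<close>
  the function \<open>G\<close> is a quadratic with positive leading coefficient, so that every state with
  \<open>G \<le> 0\<close> lies between two states with \<open>G = 0\<close>. Conversely \<open>G \<le> 0\<close> is stable under lamination.
  For \<open>wave_cone0\<close> this is convexity of \<open>G\<close>. Along a direction of \<open>wave_cone1\<close>, parametrised by
  \<open>\<theta>\<close>, the condition on \<open>\<omega>\<close> cancels the fourth order term, so \<open>G\<close> is a cubic. Since
  \<open>G \<ge> 0\<close> at \<open>\<theta> = \<plusminus>1\<close>, partial fractions exhibit \<open>G / (1 - \<theta>\<^sup>2)\<close> as a convex function.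
\<close>

section \<open>The polynomial G behind the defining inequality\<close>

definition defect :: "real \<Rightarrow> state \<Rightarrow> real" where
  "defect A = (\<lambda>(\<theta>, u, m). (1 - \<theta> * A) * (norm (m - \<theta> *\<^sub>R u))\<^sup>2
      + (1 - \<theta>\<^sup>2) * ((m - \<theta> *\<^sub>R u) \<bullet> (A *\<^sub>R u + \<i>)))"

definition defect_sublevel :: "real \<Rightarrow> state set" where
  "defect_sublevel A = {z. fst z \<in> {-1..1} \<and> defect A z \<le> 0}"

lemma one_minus_mult_pos:
  fixes A \<theta> :: real
  assumes "\<bar>A\<bar> < 1" "\<theta> \<in> {-1..1}"
  shows "0 < 1 - \<theta> * A" "0 < 1 + \<theta> * A"
proof -
  have "\<bar>\<theta> * A\<bar> \<le> 1 * \<bar>A\<bar>"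
    unfolding abs_mult using assms by (intro mult_right_mono) auto
  then show "0 < 1 - \<theta> * A" "0 < 1 + \<theta> * A" using assms by linarith+
qed

lemma one_minus_square_nonneg: "0 \<le> 1 - \<theta>\<^sup>2" if "\<theta> \<in> {-1..1}" for \<theta> :: real
  using that by (simp add: abs_le_iff abs_square_le_1)

lemma continuous_on_defect: "continuous_on UNIV (defect A)"
  unfolding defect_def case_prod_unfold by (intro continuous_intros)

text \<open>The squares of the two sides of the defining inequality differ by 4(1 - \<theta>A) times
  \<open>defect\<close>, and this factor is positive because |A| < 1.\<close>

lemma U_set_defect:
  assumes "\<bar>A\<bar> < 1"
  shows "z \<in> U_set A \<longleftrightarrow> fst z \<in> {-1..1} \<and> defect A z < 0"
proof -
  obtain \<theta> u m where z: "z = (\<theta>, u, m)" using prod_cases3 by blast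
  define w E where "w = m - \<theta> *\<^sub>R u" and "E = A *\<^sub>R u + \<i>"
  have "cmod (2 * (1 - of_real \<theta> * of_real A) * (m - of_real \<theta> * u)
           + (1 - (of_real \<theta>)\<^sup>2) * (of_real A * u + \<i>)) < (1 - \<theta>\<^sup>2) * cmod (of_real A * u + \<i>)
      \<longleftrightarrow> defect A z < 0" (is "cmod ?X < ?Y \<longleftrightarrow> _") if \<theta>: "\<theta> \<in> {-1..1}"
  proof -
    have X: "?X = (2 * (1 - \<theta> * A)) *\<^sub>R w + (1 - \<theta>\<^sup>2) *\<^sub>R E"
      and Y: "?Y = (1 - \<theta>\<^sup>2) * cmod E"
      by (simp_all add: w_def E_def scaleR_conv_of_real)
    have "cmod ?X < ?Y \<longleftrightarrow> (cmod ?X)\<^sup>2 < ?Y\<^sup>2"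
      using one_minus_square_nonneg[OF \<theta>]
      by (metis Y mult_nonneg_nonneg norm_ge_zero abs_of_nonneg abs_norm_cancel real_sqrt_abs
            real_sqrt_less_iff)
    also have "\<dots> \<longleftrightarrow> 4 * (1 - \<theta> * A) * defect A z < 0"
    proof -
      have "(cmod ?X)\<^sup>2 - ?Y\<^sup>2 = 4 * (1 - \<theta> * A) * defect A z"
        unfolding X Y defect_def z prod.case w_def[symmetric] E_def[symmetric] power_mult_distrib
          power2_norm_eq_inner
        by (simp add: inner_simps inner_commute[of E w] power2_eq_square algebra_simps)
      then show ?thesis by linarith
    qed
    also have "\<dots> \<longleftrightarrow> defect A z < 0"
      using one_minus_mult_pos[OF assms \<theta>] by (simp add: mult_less_0_iff)
    finally show ?thesis .
  qed
  then show ?thesis unfolding z U_set_def by auto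
qed

section \<open>The closure of \<open>U_set\<close>\<close>

text \<open>At most one u is excluded, so the excluded set has empty interior. States with Au + \<i>
  = 0 never satisfy the strict inequality and can be reached only as limits in u.\<close>

lemma closure_nonzero_affine: "closure {u::complex. A *\<^sub>R u + \<i> \<noteq> 0} = UNIV"
proof -
  have "{u::complex. A *\<^sub>R u + \<i> = 0} \<subseteq> {- ((1 / A) *\<^sub>R \<i>)}"
  proof
    fix u :: complex
    assume "u \<in> {u. A *\<^sub>R u + \<i> = 0}"
    then have e: "A *\<^sub>R u = - \<i>" by (simp add: eq_neg_iff_add_eq_0)
    then have "A \<noteq> 0" by auto
    then have "u = (1 / A) *\<^sub>R (A *\<^sub>R u)" by simp
    then show "u \<in> {- ((1 / A) *\<^sub>R \<i>)}" unfolding e by simp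
  qed
  then have "interior {u::complex. A *\<^sub>R u + \<i> = 0} = {}"
    using interior_mono interior_singleton by blast
  moreover have "{u::complex. A *\<^sub>R u + \<i> \<noteq> 0} = - {u. A *\<^sub>R u + \<i> = 0}" by auto
  ultimately show ?thesis by (simp only: closure_complement) auto
qed

text \<open>For fixed \<theta> and u, the m with nonpositive defect form a disc. Here \<xi> is the
  coordinate that rescales it to the unit disc: 2(1 - \<theta>A)w + (1 - \<theta>^2)E = (1 -
  \<theta>^2)|E|\<xi>.\<close>

lemma defect_ball_param:
  assumes A: "\<bar>A\<bar> < 1" and \<theta>: "\<theta> \<in> {-1..1}"
    and m: "m = \<theta> *\<^sub>R u + ((1 - \<theta>\<^sup>2) / (2 * (1 - \<theta> * A))) *\<^sub>R (norm (A *\<^sub>R u + \<i>) *\<^sub>R \<xi> - (A *\<^sub>R u + \<i>))"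
  shows "4 * (1 - \<theta> * A) * defect A (\<theta>, u, m)
    = ((1 - \<theta>\<^sup>2) * norm (A *\<^sub>R u + \<i>))\<^sup>2 * ((norm \<xi>)\<^sup>2 - 1)"
proof -
  define w E k where "w = m - \<theta> *\<^sub>R u" and "E = A *\<^sub>R u + \<i>"
    and "k = (1 - \<theta>\<^sup>2) / (2 * (1 - \<theta> * A))"
  have p: "1 - \<theta> * A \<noteq> 0" using one_minus_mult_pos[OF A \<theta>] by simp
  have w: "w = k *\<^sub>R (norm E *\<^sub>R \<xi> - E)" using m by (simp add: w_def E_def k_def)
  have k: "1 - \<theta>\<^sup>2 = 2 * (1 - \<theta> * A) * k" using p by (simp add: k_def)
  have D: "defect A (\<theta>, u, m) = (1 - \<theta> * A) * (w \<bullet> w) + (2 * (1 - \<theta> * A) * k) * (w \<bullet> E)"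
    unfolding defect_def prod.case w_def[symmetric] E_def[symmetric] power2_norm_eq_inner k ..
  have E: "E \<bullet> E = norm E * norm E" by (simp add: dot_square_norm power2_eq_square)
  show ?thesis
    unfolding D k E_def[symmetric] w power_mult_distrib power2_norm_eq_inner
    by (simp add: inner_simps inner_commute[of E \<xi>] E power2_eq_square algebra_simps)
qed

text \<open>The nontrivial inclusion comes from the disc parametrisation \<open>\<Phi>\<close>: it
  is continuous on \<open>closure S\<close>, maps \<open>S\<close> into \<open>U_set A\<close>, and
  maps \<open>closure S\<close> onto a set containing the whole sublevel set.\<close>

lemma closure_U_set:
  assumes A: "\<bar>A\<bar> < 1"
  shows "closure (U_set A) = defect_sublevel A"
proof
  have "closed (defect_sublevel A)"
  proof -
    have "defect_sublevel A = {z. fst z \<in> {-1..1}} \<inter> {z. defect A z \<le> 0}"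
      by (auto simp: defect_sublevel_def)
    moreover have "closed {z. defect A z \<le> 0}"
      by (intro closed_Collect_le continuous_on_defect continuous_intros)
    moreover have "closed {z::state. fst z \<in> {-1..1}}"
      using closed_vimage_fst[of "{-1..1::real}"] by (simp add: vimage_def)
    ultimately show ?thesis by (simp add: closed_Int)
  qed
  moreover have "U_set A \<subseteq> defect_sublevel A"
    using U_set_defect[OF A] by (force simp: defect_sublevel_def)
  ultimately show "closure (U_set A) \<subseteq> defect_sublevel A" by (rule closure_minimal[rotated])
next
  define \<Phi> :: "real \<times> complex \<times> complex \<Rightarrow> state" where
    "\<Phi> = (\<lambda>(\<theta>, u, \<xi>). (\<theta>, u, \<theta> *\<^sub>R u
        + ((1 - \<theta>\<^sup>2) / (2 * (1 - \<theta> * A))) *\<^sub>R (norm (A *\<^sub>R u + \<i>) *\<^sub>R \<xi> - (A *\<^sub>R u + \<i>))))"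
  \<comment> \<open>The three factors exclude the cases in which the defect vanishes: |\<theta>| =
    1, E = 0 and |\<xi>| = 1. As \<open>S\<close> is a product, its closure can be taken factor by
    factor.\<close>
  define S :: "(real \<times> complex \<times> complex) set" where
    "S = {-1<..<1} \<times> {u. A *\<^sub>R u + \<i> \<noteq> 0} \<times> ball 0 1"
  have cl: "closure S = {-1..1} \<times> UNIV \<times> cball 0 1"
    unfolding S_def closure_Times closure_nonzero_affine by simp
  have "continuous_on (closure S) \<Phi>"
    unfolding \<Phi>_def case_prod_unfold cl using one_minus_mult_pos[OF A]
    by (intro continuous_intros) (auto simp: less_le)
  then have *: "\<Phi> ` closure S \<subseteq> closure (\<Phi> ` S)"
    by (metis closed_closure closure_subset image_closure_subset)
  have "\<Phi> p \<in> U_set A" if "p \<in> S" for p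
  proof -
    obtain \<theta> u \<xi> where p: "p = (\<theta>, u, \<xi>)" using prod_cases3 by blast
    have \<theta>: "\<theta> \<in> {-1..1}" "\<bar>\<theta>\<bar> < 1" and u: "A *\<^sub>R u + \<i> \<noteq> 0" and \<xi>: "norm \<xi> < 1"
      using that by (auto simp: S_def p)
    have "\<theta>\<^sup>2 < 1" using \<theta> by (simp add: abs_square_less_1)
    moreover have "(norm \<xi>)\<^sup>2 < 1" using \<xi> by (simp add: abs_square_less_1)
    ultimately have "((1 - \<theta>\<^sup>2) * norm (A *\<^sub>R u + \<i>))\<^sup>2 * ((norm \<xi>)\<^sup>2 - 1) < 0"
      using u by (intro mult_pos_neg) (auto simp: zero_less_power2)
    then have "4 * (1 - \<theta> * A) * defect A (\<Phi> (\<theta>, u, \<xi>)) < 0"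
      unfolding \<Phi>_def prod.case by (subst defect_ball_param[OF A \<theta>(1) refl])
    then have "defect A (\<Phi> (\<theta>, u, \<xi>)) < 0"
      using one_minus_mult_pos[OF A \<theta>(1)] by (simp add: mult_less_0_iff)
    moreover have "fst (\<Phi> (\<theta>, u, \<xi>)) = \<theta>" by (simp add: \<Phi>_def)
    ultimately show ?thesis using \<theta>(1) by (simp only: p U_set_defect[OF A])
  qed
  then have "\<Phi> ` closure S \<subseteq> closure (U_set A)" using * closure_mono[of "\<Phi> ` S"] by blast
  moreover have "defect_sublevel A \<subseteq> \<Phi> ` closure S"
  proof clarify
    fix \<theta> u m
    assume "(\<theta>, u, m) \<in> defect_sublevel A"
    then have \<theta>: "\<theta> \<in> {-1..1}" and d: "defect A (\<theta>, u, m) \<le> 0" by (auto simp: defect_sublevel_def)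
    note p = one_minus_mult_pos[OF A \<theta>]
    define E r where "E = A *\<^sub>R u + \<i>" and "r = (1 - \<theta>\<^sup>2) / (2 * (1 - \<theta> * A))"
    show "(\<theta>, u, m) \<in> \<Phi> ` closure S"
    proof (cases "(1 - \<theta>\<^sup>2) * norm E = 0")
      \<comment> \<open>The disc has radius zero, so m is its centre \<theta>u and \<xi> = 0
        serves.\<close>
      case True
      have "m - \<theta> *\<^sub>R u = 0"
      proof -
        have "(1 - \<theta>\<^sup>2) * ((m - \<theta> *\<^sub>R u) \<bullet> E) = 0" using True by auto
        then have "(1 - \<theta> * A) * (norm (m - \<theta> *\<^sub>R u))\<^sup>2 \<le> 0" using d by (simp only: defect_def prod.case E_def)
        then have "(norm (m - \<theta> *\<^sub>R u))\<^sup>2 \<le> 0" using p by (simp add: mult_le_0_iff)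
        then show ?thesis by simp
      qed
      moreover have "r *\<^sub>R (norm E *\<^sub>R (0::complex) - E) = 0" using True by (auto simp: r_def)
      ultimately have "(\<theta>, u, m) = \<Phi> (\<theta>, u, 0)" by (simp add: \<Phi>_def E_def r_def)
      then show ?thesis using \<theta> unfolding cl by (auto intro!: image_eqI)
    next
      case False
      then have E: "norm E \<noteq> 0" and q: "1 - \<theta>\<^sup>2 \<noteq> 0" by auto
      then have r: "r \<noteq> 0" using p by (simp add: r_def)
      define \<xi> where "\<xi> = (1 / norm E) *\<^sub>R ((1 / r) *\<^sub>R (m - \<theta> *\<^sub>R u) + E)"
      have m: "m = \<theta> *\<^sub>R u + r *\<^sub>R (norm E *\<^sub>R \<xi> - E)"
        using E r by (simp add: \<xi>_def)
      have "((1 - \<theta>\<^sup>2) * norm E)\<^sup>2 * ((norm \<xi>)\<^sup>2 - 1) = 4 * (1 - \<theta> * A) * defect A (\<theta>, u, m)"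
        using defect_ball_param[OF A \<theta>, of m u \<xi>] m by (simp add: E_def r_def)
      also have "\<dots> \<le> 0" using p d by (simp add: mult_le_0_iff)
      finally have "(norm \<xi>)\<^sup>2 \<le> 1" using False by (simp add: mult_le_0_iff zero_less_power2)
      then have "norm \<xi> \<le> 1" by (simp add: abs_square_le_1)
      moreover have "(\<theta>, u, m) = \<Phi> (\<theta>, u, \<xi>)" using m by (simp add: \<Phi>_def E_def r_def)
      ultimately show ?thesis using \<theta> unfolding cl by (auto intro!: image_eqI)
    qed
  qed
  ultimately show "defect_sublevel A \<subseteq> closure (U_set A)" by blast
qed

section \<open>Laminates and the wave cone\<close>

lemma subset_laminate_step:
  assumes "0 \<in> \<Lambda>"
  shows "K \<subseteq> laminate_step \<Lambda> K"
proof
  fix z assume "z \<in> K"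
  then show "z \<in> laminate_step \<Lambda> K"
    unfolding laminate_step_def using assms by (auto intro!: exI[of _ "1::real"] exI[of _ z])
qed

lemma laminates_subset:
  assumes "K \<subseteq> C" "laminate_step \<Lambda> C \<subseteq> C"
  shows "laminates \<Lambda> K n \<subseteq> C"
proof (induction n)
  case (Suc n)
  then have "laminate_step \<Lambda> (laminates \<Lambda> K n) \<subseteq> laminate_step \<Lambda> C"
    unfolding laminate_step_def by blast
  then show ?case using assms(2) by simp
qed (use assms in simp)

lemma zero_in_wave_cone: "0 \<in> wave_cone A"
  by (simp add: wave_cone_def wave_cone0_def zero_prod_def)

lemma cmod_two_mult_plus_one: "cmod (2 * \<omega> + 1) = 1 \<longleftrightarrow> (cmod \<omega>)\<^sup>2 + Re \<omega> = 0"
proof -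
  have "cmod (2 * \<omega> + 1) = 1 \<longleftrightarrow> (cmod (2 * \<omega> + 1))\<^sup>2 = 1"
    by (metis abs_norm_cancel one_power2 power2_eq_iff_nonneg norm_ge_zero zero_le_one)
  also have "\<dots> \<longleftrightarrow> (cmod \<omega>)\<^sup>2 + Re \<omega> = 0"
    unfolding cmod_power2 by (simp add: power2_eq_square algebra_simps) argo
  finally show ?thesis .
qed

text \<open>Removes \<omega> from the cone condition: multiplying |\<omega>|^2 + Re \<omega> = 0 by
  |B|^2 gives the right-hand side. Geometrically, d lies on the circle with diameter from 0 to
  -B.\<close>

lemma wave_cone1_inner:
  "(\<exists>\<omega>. cmod (2 * \<omega> + 1) = 1 \<and> d = \<omega> * B) \<longleftrightarrow> (norm d)\<^sup>2 + d \<bullet> B = 0"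
proof -
  have *: "(norm (\<omega> * B))\<^sup>2 + (\<omega> * B) \<bullet> B = (norm B)\<^sup>2 * ((cmod \<omega>)\<^sup>2 + Re \<omega>)" for \<omega>
    unfolding cmod_power2 by (simp add: inner_complex_def power2_eq_square algebra_simps)
  show ?thesis
  proof
    assume "\<exists>\<omega>. cmod (2 * \<omega> + 1) = 1 \<and> d = \<omega> * B"
    then show "(norm d)\<^sup>2 + d \<bullet> B = 0" using * cmod_two_mult_plus_one by auto
  next
    assume d: "(norm d)\<^sup>2 + d \<bullet> B = 0"
    show "\<exists>\<omega>. cmod (2 * \<omega> + 1) = 1 \<and> d = \<omega> * B"
    proof (cases "B = 0")
      case True
      then show ?thesis using d by (intro exI[of _ 0]) auto
    next
      case False
      then have "d = d / B * B" by simp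
      moreover from this have "(norm B)\<^sup>2 * ((cmod (d / B))\<^sup>2 + Re (d / B)) = 0"
        using *[of "d / B"] d by simp
      then have "cmod (2 * (d / B) + 1) = 1"
        using False by (simp only: cmod_two_mult_plus_one) simp
      ultimately show ?thesis by blast
    qed
  qed
qed

section \<open>First order laminates\<close>

text \<open>For |\<theta>| < 1 the state is split into (1, v + d, v + d) and (-1, v - d, -(v - d)).
  Their difference is 2(1, d, v), and vanishing of the defect is exactly the
  \<open>wave_cone1\<close> condition for it.\<close>

lemma defect_zero_in_laminates:
  assumes A: "\<bar>A\<bar> < 1" and \<theta>: "\<theta> \<in> {-1..1}" and d0: "defect A (\<theta>, u, m) = 0"
  shows "(\<theta>, u, m) \<in> laminate_step (wave_cone A) constraint_set"
proof (cases "\<theta>\<^sup>2 = 1")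
  case True
  then have "(1 - \<theta> * A) * (norm (m - \<theta> *\<^sub>R u))\<^sup>2 = 0" using d0 by (simp add: defect_def)
  then have "m - \<theta> *\<^sub>R u = 0" using one_minus_mult_pos[OF A \<theta>] by auto
  then have "(\<theta>, u, m) \<in> constraint_set"
    using True \<theta> by (auto simp: constraint_set_def power2_eq_1_iff scaleR_conv_of_real)
  then show ?thesis using subset_laminate_step[OF zero_in_wave_cone] by blast
next
  case False
  then have q: "1 - \<theta>\<^sup>2 \<noteq> 0" by simp
  \<comment> \<open>These solve u = v + \<theta>d and m = \<theta>v + d, the components of the
    weighted mean of the two endpoints.\<close>
  define d v where "d = (1 / (1 - \<theta>\<^sup>2)) *\<^sub>R (m - \<theta> *\<^sub>R u)" and "v = u - \<theta> *\<^sub>R d"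
  have w: "m - \<theta> *\<^sub>R u = (1 - \<theta>\<^sup>2) *\<^sub>R d" using q by (simp add: d_def)
  define B where "B = A *\<^sub>R v + \<i>"
  have E: "A *\<^sub>R u + \<i> = B + (A * \<theta>) *\<^sub>R d" by (simp add: B_def v_def algebra_simps)
  have "defect A (\<theta>, u, m) = (1 - \<theta>\<^sup>2)\<^sup>2 * ((norm d)\<^sup>2 + d \<bullet> B)"
    unfolding defect_def prod.case w E power2_norm_eq_inner
    by (simp add: inner_simps power2_eq_square algebra_simps)
  then have "(norm d)\<^sup>2 + d \<bullet> B = 0" using d0 q by simp
  then obtain \<omega> where \<omega>: "cmod (2 * \<omega> + 1) = 1" "d = \<omega> * B" using wave_cone1_inner by blast
  have "2 * d = \<omega> * (of_real A * (2 * v) + of_real 2 * \<i>)"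
    using \<omega>(2) by (simp add: B_def scaleR_conv_of_real algebra_simps)
  then have "(2, 2 * d, 2 * v) \<in> wave_cone A"
    using \<omega>(1) unfolding wave_cone_def wave_cone1_def by auto
  moreover have "(1::real, v + d, v + d) - (-1, v - d, - (v - d)) = (2, 2 * d, 2 * v)" by simp
  moreover have "(1, v + d, v + d) \<in> constraint_set" "(-1, v - d, - (v - d)) \<in> constraint_set"
    by (auto simp: constraint_set_def)
  moreover have "(\<theta>, u, m) = ((1 + \<theta>) / 2) *\<^sub>R (1, v + d, v + d) + ((1 - \<theta>) / 2) *\<^sub>R (-1, v - d, - (v - d))"
  proof -
    have "u = v + \<theta> *\<^sub>R d" by (simp add: v_def)
    moreover from this have "m = \<theta> *\<^sub>R v + d"
      using w by (simp add: algebra_simps power2_eq_square)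
    ultimately show ?thesis
      by (simp add: complex_eq_iff field_simps)
  qed
  ultimately show ?thesis unfolding laminate_step_def using \<theta> by fastforce
qed

section \<open>Directions of \<open>wave_cone0\<close> and second order laminates\<close>

text \<open>Along (0, -Ae, e), w moves by t(1 + \<theta>A)e and E by -tA^2 e. The leading
  coefficient factors since (1 - \<theta>A)(1 + \<theta>A) - (1 - \<theta>^2)A^2 = 1 - A^2; its sign
  yields both the convexity and the roots needed below.\<close>

lemma defect_wave_cone0:
  "defect A (\<theta>, u - t *\<^sub>R A *\<^sub>R e, m + t *\<^sub>R e)
    = defect A (\<theta>, u, m)
      + t * ((1 + \<theta> * A) * (2 * (1 - \<theta> * A) * ((m - \<theta> *\<^sub>R u) \<bullet> e) + (1 - \<theta>\<^sup>2) * (e \<bullet> (A *\<^sub>R u + \<i>)))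
            - (1 - \<theta>\<^sup>2) * A\<^sup>2 * ((m - \<theta> *\<^sub>R u) \<bullet> e))
      + t\<^sup>2 * ((1 + \<theta> * A) * (1 - A\<^sup>2) * (norm e)\<^sup>2)"
proof -
  define w E where "w = m - \<theta> *\<^sub>R u" and "E = A *\<^sub>R u + \<i>"
  have w': "(m + t *\<^sub>R e) - \<theta> *\<^sub>R (u - t *\<^sub>R A *\<^sub>R e) = w + (t * (1 + \<theta> * A)) *\<^sub>R e"
    and E': "A *\<^sub>R (u - t *\<^sub>R A *\<^sub>R e) + \<i> = E - (t * A\<^sup>2) *\<^sub>R e"
    by (simp_all add: w_def E_def algebra_simps power2_eq_square)
  show ?thesis
    unfolding defect_def prod.case w' E' w_def[symmetric] E_def[symmetric] power2_norm_eq_inner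
    by (simp add: inner_simps inner_commute[of e w] power2_eq_square algebra_simps)
qed

lemma quadratic_nonpos_between:
  fixes a b c :: real
  assumes "0 \<le> a" "c \<le> 0" "c + b + a \<le> 0" "0 \<le> t" "t \<le> 1"
  shows "c + t * b + t\<^sup>2 * a \<le> 0"
proof -
  have "t\<^sup>2 * a \<le> t * a"
    using assms by (intro mult_right_mono) (auto simp: power2_eq_square mult_left_le)
  then have "c + t * b + t\<^sup>2 * a \<le> (1 - t) * c + t * (c + b + a)" by (simp add: algebra_simps)
  also have "\<dots> \<le> 0"
  proof -
    have "(1 - t) * c \<le> 0" "t * (c + b + a) \<le> 0"
      using assms by (simp_all only: mult_nonneg_nonpos diff_ge_0_iff_ge)
    then show ?thesis by simp
  qed
  finally show ?thesis .
qed

lemma quadratic_root_nonneg: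
  fixes a b c :: real
  assumes "0 < a" "c \<le> 0"
  shows "\<exists>t\<ge>0. c + t * b + t\<^sup>2 * a = 0"
proof -
  \<comment> \<open>Large enough that T^2 a dominates Tb and c, so the quadratic is nonnegative at T
    and the intermediate value theorem applies on [0, T].\<close>
  define T where "T = 1 + (\<bar>b\<bar> + \<bar>c\<bar>) / a"
  have T: "1 \<le> T" "a * T = a + \<bar>b\<bar> + \<bar>c\<bar>" using assms by (simp_all add: T_def field_simps)
  have "0 \<le> T * (a + (\<bar>b\<bar> + b))" "0 \<le> (T - 1) * \<bar>c\<bar>"
    using T(1) assms by (intro mult_nonneg_nonneg; simp)+
  moreover have "T\<^sup>2 * a = T * (a + \<bar>b\<bar> + \<bar>c\<bar>)" by (simp add: T(2)[symmetric] power2_eq_square)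
  ultimately have "0 \<le> c + T * b + T\<^sup>2 * a" using assms(2) by (simp add: algebra_simps)
  then have "\<exists>t\<ge>0. t \<le> T \<and> c + t * b + t\<^sup>2 * a = 0"
    using T assms by (intro IVT') (auto intro!: continuous_intros)
  then show ?thesis by blast
qed

lemma defect_sublevel_in_laminates:
  assumes A: "\<bar>A\<bar> < 1" and z: "z \<in> defect_sublevel A"
  shows "z \<in> laminate_step (wave_cone A) (laminate_step (wave_cone A) constraint_set)"
proof -
  obtain \<theta> u m where z': "z = (\<theta>, u, m)" using prod_cases3 by blast
  have \<theta>: "\<theta> \<in> {-1..1}" and c: "defect A (\<theta>, u, m) \<le> 0"
    using z by (auto simp: z' defect_sublevel_def)
  \<comment> \<open>The line through the state in the direction (0, -A, 1); any nonzero e in place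
    of 1 would give a positive leading coefficient.\<close>
  define \<gamma> where "\<gamma> = (\<lambda>t. (\<theta>, u - t *\<^sub>R A *\<^sub>R (1::complex), m + t *\<^sub>R (1::complex)))"
  define c where "c = defect A (\<theta>, u, m)"
  obtain a b where G: "\<And>t. defect A (\<gamma> t) = c + t * b + t\<^sup>2 * a" and a: "0 < a"
  proof
    show "0 < (1 + \<theta> * A) * (1 - A\<^sup>2) * (norm (1::complex))\<^sup>2"
      using one_minus_mult_pos[OF A \<theta>] A by (simp add: abs_square_less_1)
    show "defect A (\<gamma> t) = c + t * ((1 + \<theta> * A) * (2 * (1 - \<theta> * A) * ((m - \<theta> *\<^sub>R u) \<bullet> 1)
            + (1 - \<theta>\<^sup>2) * (1 \<bullet> (A *\<^sub>R u + \<i>))) - (1 - \<theta>\<^sup>2) * A\<^sup>2 * ((m - \<theta> *\<^sub>R u) \<bullet> 1))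
        + t\<^sup>2 * ((1 + \<theta> * A) * (1 - A\<^sup>2) * (norm (1::complex))\<^sup>2)" for t
      unfolding \<gamma>_def c_def by (rule defect_wave_cone0)
  qed
  have "c \<le> 0" using c by (simp add: c_def)
  from quadratic_root_nonneg[OF a this, of b] obtain p where p: "0 \<le> p" "defect A (\<gamma> p) = 0"
    unfolding G by auto
  \<comment> \<open>Reflecting t to -t turns the root on the negative side into a nonnegative
    one.\<close>
  from quadratic_root_nonneg[OF a \<open>c \<le> 0\<close>, of "- b"]
  obtain n where n: "0 \<le> n" "c + n * - b + n\<^sup>2 * a = 0" by blast
  then have n': "defect A (\<gamma> (- n)) = 0" by (simp add: G)
  have lam: "\<gamma> p \<in> laminate_step (wave_cone A) constraint_set"
    "\<gamma> (- n) \<in> laminate_step (wave_cone A) constraint_set"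
    using defect_zero_in_laminates[OF A \<theta>] p(2) n' by (simp_all add: \<gamma>_def)
  have cone: "\<gamma> p - \<gamma> (- n) \<in> wave_cone A"
    by (simp add: wave_cone_def wave_cone0_def \<gamma>_def scaleR_conv_of_real algebra_simps)
  show ?thesis
  proof (cases "p + n = 0")
    \<comment> \<open>Both roots are at t = 0, so the state itself has zero defect and is already a
      first order laminate.\<close>
    case True
    then have "z = \<gamma> p" using p n by (simp add: z' \<gamma>_def)
    then show ?thesis using lam(1) subset_laminate_step[OF zero_in_wave_cone] by blast
  next
    case False
    then have pn: "0 < p + n" using p n by simp
    \<comment> \<open>Chosen so that the weights n/(p + n) at p and p/(p + n) at -n average the
      parameters to 0.\<close>
    define s where "s = (n - p) / (p + n)"
    have s: "s \<in> {-1..1}" using p n pn by (simp add: s_def field_simps)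
    have "(1 + s) / 2 = n / (p + n)" "(1 - s) / 2 = p / (p + n)"
      using pn by (simp_all add: s_def field_simps)
    moreover have "(n / (p + n)) *\<^sub>R \<gamma> p + (p / (p + n)) *\<^sub>R \<gamma> (- n) = z"
    proof -
      define \<mu> \<nu> where "\<mu> = n / (p + n)" and "\<nu> = p / (p + n)"
      have \<nu>: "\<nu> = 1 - \<mu>" using pn by (simp add: \<mu>_def \<nu>_def field_simps)
      have "\<mu> * p = \<nu> * n" by (simp add: \<mu>_def \<nu>_def)
      then have "\<mu> * p = n - \<mu> * n" by (simp add: \<nu> algebra_simps)
      then have "\<mu> *\<^sub>R \<gamma> p + \<nu> *\<^sub>R \<gamma> (- n) = z"
        unfolding \<nu> z' \<gamma>_def by (simp add: complex_eq_iff, algebra)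
      then show ?thesis by (simp only: \<mu>_def \<nu>_def)
    qed
    ultimately have "z = ((1 + s) / 2) *\<^sub>R \<gamma> p + ((1 - s) / 2) *\<^sub>R \<gamma> (- n)" by (simp only:)
    then show ?thesis
      unfolding laminate_step_def[of _ "laminate_step (wave_cone A) constraint_set"]
      using s lam cone by blast
  qed
qed

section \<open>Stability of the sublevel set under lamination\<close>

text \<open>
  The cubic is written as \<open>(1 - t\<^sup>2)(\<alpha> + \<beta>t) + a(1 + t) + b(1 - t)\<close>. The last two assumptions say
  that a zero at \<open>t = \<plusminus>1\<close> is a double one; without them the claim fails for segments that
  start there.
\<close>

lemma cubic_nonpos_between:
  fixes \<alpha> \<beta> a b :: real
  defines "g \<equiv> (\<lambda>t. (1 - t\<^sup>2) * (\<alpha> + \<beta> * t) + a * (1 + t) + b * (1 - t))"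
  assumes ab: "0 \<le> a" "0 \<le> b"
    and one: "a = 0 \<Longrightarrow> 2 * (\<alpha> + \<beta>) + b = 0" and minus_one: "b = 0 \<Longrightarrow> 2 * (\<alpha> - \<beta>) + a = 0"
    and x: "x \<in> {-1..1}" "g x \<le> 0" and y: "y \<in> {-1..1}" "g y \<le> 0"
    and s: "0 < s" "s < 1" and xy: "x \<noteq> y"
  shows "g (s * x + (1 - s) * y) \<le> 0"
proof -
  \<comment> \<open>This is g(t)/(1 - t^2) in partial fractions; it is convex on (-1, 1) because a
    and b are nonnegative.\<close>
  define h where "h = (\<lambda>t. \<alpha> + \<beta> * t + a * inverse (1 - t) + b * inverse (1 + t))"
  have gh: "g t = (1 - t\<^sup>2) * h t" if "-1 < t" "t < 1" for t
  proof -
    have "(1 - t) * inverse (1 - t) = 1" "(1 + t) * inverse (1 + t) = 1" using that by simp_all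
    then show ?thesis unfolding g_def h_def power2_eq_square by algebra
  qed
  \<comment> \<open>At the endpoints this uses \<open>inverse 0 = 0\<close>: the coefficient of the singular term vanishes there.\<close>
  have h: "h t \<le> 0" if "t \<in> {-1..1}" "g t \<le> 0" for t
  proof -
    consider "t = 1" | "t = -1" | "-1 < t" "t < 1" using \<open>t \<in> {-1..1}\<close> by fastforce
    then show ?thesis
    proof cases
      case 1
      then have "a = 0" using that ab by (simp add: g_def)
      then show ?thesis using one 1 by (simp add: h_def)
    next
      case 2
      then have "b = 0" using that ab by (simp add: g_def)
      then show ?thesis using minus_one 2 by (simp add: h_def)
    next
      case 3
      then have "0 < 1 - t\<^sup>2" by (simp add: abs_square_less_1)
      then show ?thesis using gh[OF 3] that by (simp add: mult_le_0_iff)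
    qed
  qed
  define t where "t = s * x + (1 - s) * y"
  \<comment> \<open>Since x and y differ, a point strictly between them avoids both ends -1 and 1,
    so the factorisation \<open>gh\<close> holds there.\<close>
  have "0 < s * (1 + x) + (1 - s) * (1 + y)" "0 < s * (1 - x) + (1 - s) * (1 - y)"
  proof -
    have "x \<noteq> - 1 \<or> y \<noteq> - 1" "x \<noteq> 1 \<or> y \<noteq> 1" using xy by auto
    then show "0 < s * (1 + x) + (1 - s) * (1 + y)" "0 < s * (1 - x) + (1 - s) * (1 - y)"
      using x y s by (auto simp: less_le add_nonneg_eq_0_iff intro!: add_nonneg_nonneg)
  qed
  then have t: "-1 < t" "t < 1" by (simp_all add: t_def algebra_simps)
  \<comment> \<open>Convexity of c/r for r > 0, extended to arguments at 0, where c = 0 makes the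
    claim trivial.\<close>
  have inv_convex: "c * inverse (s * p + (1 - s) * q) \<le> s * (c * inverse p) + (1 - s) * (c * inverse q)"
    if "0 \<le> c" "0 \<le> p" "0 \<le> q" "p = 0 \<Longrightarrow> c = 0" "q = 0 \<Longrightarrow> c = 0" for c p q
  proof (cases "c = 0")
    case False
    then have pq: "0 < p" "0 < q" using that by (auto simp: less_le)
    have "inverse (s * p + (1 - s) * q) \<le> s * inverse p + (1 - s) * inverse q"
      using convex_onD[OF convex_on_inverse[of "{0<..}"], of "1 - s" p q] pq s by simp
    then have "c * inverse (s * p + (1 - s) * q) \<le> c * (s * inverse p + (1 - s) * inverse q)"
      using that(1) by (rule mult_left_mono)
    then show ?thesis by (simp add: algebra_simps)
  qed simp
  have za: "v = 1 \<Longrightarrow> a = 0" and zb: "v = -1 \<Longrightarrow> b = 0" if "v \<in> {x, y}" for v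
    using that x y ab by (auto simp: g_def)
  have "a * inverse (s * (1 - x) + (1 - s) * (1 - y))
      \<le> s * (a * inverse (1 - x)) + (1 - s) * (a * inverse (1 - y))"
    using x y ab za by (intro inv_convex) auto
  moreover have "b * inverse (s * (1 + x) + (1 - s) * (1 + y))
      \<le> s * (b * inverse (1 + x)) + (1 - s) * (b * inverse (1 + y))"
    using x y ab zb[of x] zb[of y] by (intro inv_convex) auto
  moreover have "s * (1 - x) + (1 - s) * (1 - y) = 1 - t" "s * (1 + x) + (1 - s) * (1 + y) = 1 + t"
    by (simp_all add: t_def algebra_simps)
  ultimately have "h t \<le> s * h x + (1 - s) * h y" unfolding h_def t_def by (simp add: algebra_simps)
  also have "\<dots> \<le> 0" using h x y s by (intro add_nonpos_nonpos mult_nonneg_nonpos) auto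
  finally have "h t \<le> 0" .
  moreover have "0 \<le> 1 - t\<^sup>2" using t by (intro one_minus_square_nonneg) simp
  ultimately show ?thesis using gh[OF t] by (simp add: t_def mult_le_0_iff)
qed

text \<open>On the line, w is quadratic in t. The fifth order terms always cancel, and the
  assumption on d kills the fourth order one. If a = 0 then w vanishes at t = 1, so both summands of
  the defect have a double zero there, which is the stated relation; likewise for b at t =
  -1.\<close>

lemma defect_wave_cone1_cubic:
  fixes u0 m0 d n :: complex
  assumes A: "\<bar>A\<bar> < 1" and d: "(norm d)\<^sup>2 + d \<bullet> (A *\<^sub>R n + \<i>) = 0"
  obtains \<alpha> \<beta> a b where
    "\<And>t. defect A (t, u0 + t *\<^sub>R d, m0 + t *\<^sub>R n) = (1 - t\<^sup>2) * (\<alpha> + \<beta> * t) + a * (1 + t) + b * (1 - t)"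
    "0 \<le> a" "0 \<le> b" "a = 0 \<Longrightarrow> 2 * (\<alpha> + \<beta>) + b = 0" "b = 0 \<Longrightarrow> 2 * (\<alpha> - \<beta>) + a = 0"
proof -
  define w1 E where "w1 = n - u0" and "E = A *\<^sub>R u0 + \<i>"
  \<comment> \<open>The constants are read off from the line: 2a and 2b are the defects at t = 1 and
    t = -1, \<alpha> + a + b is the defect at t = 0, and -\<beta> is the coefficient of t^3.\<close>
  define a where "a = (1 - A) / 2 * (norm (m0 + w1 - d))\<^sup>2"
  define b where "b = (1 + A) / 2 * (norm (m0 - w1 - d))\<^sup>2"
  define \<alpha> where "\<alpha> = m0 \<bullet> m0 + m0 \<bullet> E - a - b"
  define \<beta> where "\<beta> = m0 \<bullet> (A *\<^sub>R d) + w1 \<bullet> E + A * (d \<bullet> d) + 2 * (w1 \<bullet> d) + A * (w1 \<bullet> w1 - 2 * (m0 \<bullet> d))"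
  have w: "m0 + t *\<^sub>R n - t *\<^sub>R (u0 + t *\<^sub>R d) = m0 + t *\<^sub>R w1 - (t * t) *\<^sub>R d"
    and E: "A *\<^sub>R (u0 + t *\<^sub>R d) + \<i> = E + (t * A) *\<^sub>R d" for t
    by (simp_all add: w1_def E_def algebra_simps)
  have "A *\<^sub>R n + \<i> = A *\<^sub>R w1 + E" by (simp add: w1_def E_def algebra_simps)
  \<comment> \<open>The left-hand side is the coefficient of t^4 in the defect.\<close>
  then have Q: "d \<bullet> d + A * (w1 \<bullet> d) + d \<bullet> E = 0"
    using d by (simp add: power2_norm_eq_inner inner_simps inner_commute)
  note dot = inner_simps inner_commute[of d w1] inner_commute[of d m0] inner_commute[of w1 m0]
  show thesis
  proof
    show "defect A (t, u0 + t *\<^sub>R d, m0 + t *\<^sub>R n)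
        = (1 - t\<^sup>2) * (\<alpha> + \<beta> * t) + a * (1 + t) + b * (1 - t)" for t
    proof -
      have dE: "d \<bullet> E = - (d \<bullet> d) - A * (w1 \<bullet> d)" using Q by simp
      show ?thesis
        unfolding defect_def prod.case w E \<alpha>_def \<beta>_def a_def b_def power2_norm_eq_inner
        by (simp add: dot dE power2_eq_square field_simps)
    qed
    show "0 \<le> a" "0 \<le> b" using A by (simp_all add: a_def b_def)
    show "2 * (\<alpha> + \<beta>) + b = 0" if "a = 0"
    proof -
      have "m0 + w1 - d = 0" using that A by (auto simp: a_def)
      then have m0: "m0 = d - w1" by (simp add: algebra_simps)
      then have "m0 - w1 - d = (- 2) *\<^sub>R w1" by (simp add: scaleR_2)
      then have b: "b = (1 + A) * 2 * (w1 \<bullet> w1)" by (simp add: b_def power2_norm_eq_inner)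
      have dE: "d \<bullet> E = - (d \<bullet> d) - A * (w1 \<bullet> d)" using Q by simp
      show ?thesis
        unfolding \<alpha>_def \<beta>_def that unfolding b m0
        by (simp add: dot dE field_simps)
    qed
    show "2 * (\<alpha> - \<beta>) + a = 0" if "b = 0"
    proof -
      have "m0 - w1 - d = 0" using that A by (auto simp: b_def)
      then have m0: "m0 = d + w1" by (simp add: algebra_simps)
      then have "m0 + w1 - d = 2 *\<^sub>R w1" by (simp add: scaleR_2)
      then have a: "a = (1 - A) * 2 * (w1 \<bullet> w1)" by (simp add: a_def power2_norm_eq_inner)
      have dE: "d \<bullet> E = - (d \<bullet> d) - A * (w1 \<bullet> d)" using Q by simp
      show ?thesis
        unfolding \<alpha>_def \<beta>_def that unfolding a m0
        by (simp add: dot dE field_simps)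
    qed
  qed
qed

lemma laminate_step_defect_sublevel:
  assumes A: "\<bar>A\<bar> < 1"
  shows "laminate_step (wave_cone A) (defect_sublevel A) \<subseteq> defect_sublevel A"
proof -
  \<comment> \<open>Here s is the weight of z1 itself, strictly between 0 and 1; the weights 0 and 1
    just return an endpoint and are treated last.\<close>
  have "s *\<^sub>R z1 + (1 - s) *\<^sub>R z2 \<in> defect_sublevel A"
    if z: "z1 \<in> defect_sublevel A" "z2 \<in> defect_sublevel A" "z1 - z2 \<in> wave_cone A"
      and s: "0 < s" "s < 1" for z1 z2 s
  proof -
    obtain x u1 m1 where z1: "z1 = (x, u1, m1)" using prod_cases3 by blast
    obtain y u2 m2 where z2: "z2 = (y, u2, m2)" using prod_cases3 by blast
    have x: "x \<in> {-1..1}" "defect A (x, u1, m1) \<le> 0" and y: "y \<in> {-1..1}" "defect A (y, u2, m2) \<le> 0"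
      using z by (auto simp: z1 z2 defect_sublevel_def)
    have "s * x + (1 - s) * y \<in> {-1..1}"
      using convexD[OF convex_real_interval(5)[of "-1" 1] x(1) y(1), of s "1 - s"] s by simp
    moreover have "defect A (s * x + (1 - s) * y, s *\<^sub>R u1 + (1 - s) *\<^sub>R u2, s *\<^sub>R m1 + (1 - s) *\<^sub>R m2) \<le> 0"
    proof (cases "x = y")
      case True
      define e where "e = m1 - m2"
      have "u1 - u2 = - (of_real A * e)"
        using z(3) True by (simp add: z1 z2 e_def wave_cone_def wave_cone0_def wave_cone1_def)
      then have u1: "u1 = u2 - A *\<^sub>R e" by (simp add: scaleR_conv_of_real algebra_simps)
      have m1: "m1 = m2 + e" by (simp add: e_def)
      define a where "a = (1 + y * A) * (1 - A\<^sup>2) * (norm e)\<^sup>2"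
      have a: "0 \<le> a"
        using one_minus_mult_pos[OF A y(1)] A
        by (auto simp: a_def abs_square_le_1 intro!: mult_nonneg_nonneg)
      obtain b where G: "\<And>t. defect A (y, u2 - t *\<^sub>R A *\<^sub>R e, m2 + t *\<^sub>R e)
          = defect A (y, u2, m2) + t * b + t\<^sup>2 * a"
        unfolding a_def using defect_wave_cone0 by blast
      have "defect A (y, u2, m2) + s * b + s\<^sup>2 * a \<le> 0"
        using y(2) x(2) G[of 1] True s a by (intro quadratic_nonpos_between) (auto simp: u1 m1)
      moreover have "s *\<^sub>R u1 + (1 - s) *\<^sub>R u2 = u2 - s *\<^sub>R A *\<^sub>R e"
        "s *\<^sub>R m1 + (1 - s) *\<^sub>R m2 = m2 + s *\<^sub>R e" "s * x + (1 - s) * y = y"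
        unfolding u1 m1 True by (simp_all add: algebra_simps)
      ultimately show ?thesis using G[of s] by simp
    next
      case False
      \<comment> \<open>Rescaling the difference to (1, d, n) makes \<theta> the parameter of the
        line.\<close>
      define k d n where "k = 1 / (x - y)" and "d = k *\<^sub>R (u1 - u2)" and "n = k *\<^sub>R (m1 - m2)"
      have k: "k * (x - y) = 1" using False by (simp add: k_def)
      obtain \<omega> where \<omega>: "cmod (2 * \<omega> + 1) = 1"
        and u: "u1 - u2 = \<omega> * (of_real A * (m1 - m2) + of_real (x - y) * \<i>)"
        using z(3) False by (auto simp: z1 z2 wave_cone_def wave_cone0_def wave_cone1_def)
      have "d = \<omega> * (A *\<^sub>R n + (k * (x - y)) *\<^sub>R \<i>)"
        unfolding d_def n_def u by (simp add: scaleR_conv_of_real algebra_simps)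
      then have "d = \<omega> * (A *\<^sub>R n + \<i>)" unfolding k by simp
      then have d: "(norm d)\<^sup>2 + d \<bullet> (A *\<^sub>R n + \<i>) = 0" using \<omega> wave_cone1_inner by blast
      \<comment> \<open>The point of the line at \<theta> = 0, which need not lie on the
        segment.\<close>
      define u0 m0 where "u0 = u2 - y *\<^sub>R d" and "m0 = m2 - y *\<^sub>R n"
      obtain \<alpha> \<beta> a b where G:
        "\<And>t. defect A (t, u0 + t *\<^sub>R d, m0 + t *\<^sub>R n) = (1 - t\<^sup>2) * (\<alpha> + \<beta> * t) + a * (1 + t) + b * (1 - t)"
        and ab: "0 \<le> a" "0 \<le> b" "a = 0 \<Longrightarrow> 2 * (\<alpha> + \<beta>) + b = 0" "b = 0 \<Longrightarrow> 2 * (\<alpha> - \<beta>) + a = 0"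
        using defect_wave_cone1_cubic[OF A d] by blast
      have "(x - y) *\<^sub>R d = u1 - u2" "(x - y) *\<^sub>R n = m1 - m2"
        unfolding d_def n_def scaleR_scaleR mult.commute[of "x - y"] k by simp_all
      then have um: "u1 = u0 + x *\<^sub>R d" "m1 = m0 + x *\<^sub>R n" "u2 = u0 + y *\<^sub>R d" "m2 = m0 + y *\<^sub>R n"
        by (simp_all add: u0_def m0_def algebra_simps)
      have lin: "s *\<^sub>R (c + x *\<^sub>R e) + (1 - s) *\<^sub>R (c + y *\<^sub>R e) = c + (s * x + (1 - s) * y) *\<^sub>R e"
        for c e :: complex
        by (simp add: algebra_simps)
      show ?thesis
        using cubic_nonpos_between[OF ab x(1) _ y(1) _ s False] x(2) y(2) unfolding um lin G by blast
    qed
    ultimately show ?thesis by (simp add: z1 z2 defect_sublevel_def)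
  qed
  note interior = this
  show ?thesis
  proof
    fix z assume "z \<in> laminate_step (wave_cone A) (defect_sublevel A)"
    then obtain s z1 z2 where s: "s \<in> {-1..1}"
      and z: "z1 \<in> defect_sublevel A" "z2 \<in> defect_sublevel A" "z1 - z2 \<in> wave_cone A"
      and eq: "z = ((1 + s) / 2) *\<^sub>R z1 + ((1 - s) / 2) *\<^sub>R z2"
      unfolding laminate_step_def by blast
    consider "s = 1" | "s = -1" | "-1 < s" "s < 1" using s by fastforce
    then show "z \<in> defect_sublevel A"
    proof cases
      case 3
      have "1 - (1 + s) / 2 = (1 - s) / 2" by (simp add: field_simps)
      moreover have "0 < (1 + s) / 2" "(1 + s) / 2 < 1" using 3 by simp_all
      ultimately show ?thesis using interior[OF z] unfolding eq by metis
    qed (use z eq in auto)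
  qed
qed

section \<open>Equality of the hull, the second order laminates and the closure\<close>

lemma constraint_set_subset: "constraint_set \<subseteq> defect_sublevel A"
  by (auto simp: constraint_set_def defect_sublevel_def defect_def scaleR_conv_of_real)

theorem proposition4p1:
  fixes A :: real
  assumes "\<bar>A\<bar> < 1"
  shows "lamination_hull (wave_cone A) constraint_set = laminates (wave_cone A) constraint_set 2
       \<and> laminates (wave_cone A) constraint_set 2 = closure (U_set A)"
proof -
  have sub: "laminates (wave_cone A) constraint_set n \<subseteq> defect_sublevel A" for n
    by (intro laminates_subset constraint_set_subset laminate_step_defect_sublevel assms)
  moreover have "defect_sublevel A \<subseteq> laminates (wave_cone A) constraint_set 2"
    using defect_sublevel_in_laminates[OF assms] by (auto simp: numeral_2_eq_2)
  ultimately have two: "laminates (wave_cone A) constraint_set 2 = defect_sublevel A" by blast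
  moreover have "lamination_hull (wave_cone A) constraint_set = defect_sublevel A"
  proof
    show "lamination_hull (wave_cone A) constraint_set \<subseteq> defect_sublevel A"
      using sub by (auto simp: lamination_hull_def)
    have "2 \<in> {1::nat..}" by simp
    then show "defect_sublevel A \<subseteq> lamination_hull (wave_cone A) constraint_set"
      unfolding lamination_hull_def two[symmetric] by blast
  qed
  ultimately show ?thesis using closure_U_set[OF assms] by simp
qed

end
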